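(* Let $G$ be a topological group and let $H$ be a subgroup of $G$ such that $G = \mathrm{Dist}^*_{G/H}(H)$. Let $X$ be a topological space admitting an action of $G$ by homeomorphisms, such that the map $G \rightarrow X,\ g \mapsto gx$ is continuous for all $x \in X$. Let $x \in X$; suppose that $x$ is fixed by $H$, and that no $H$-orbit on $X \setminus \{x\}$ accumulates at $x$. Then $x$ is fixed by $G$.
   Context: For a subgroup $H$ of a topological group $G$, $\mathrm{Dist}^*_{G/H}(H)$ denotes the smallest closed subgroup $E$ of $G$ with $H \le E$ (so $E$ is invariant under conjugation by $H$) such that the action of $H$ on the coset space $G/E$ (by conjugation, or equivalently, since $H \le E$, by left translation) is distal at $1$, meaning that no $H$-orbit of a non-trivial coset accumulates at the trivial coset $E$. (It is the intersection of all closed subgroups $E \geq H$ with this property.) An orbit accumulates at a point $p$ (not lying in the orbit) if $p$ lies in the closure of the orbit. *)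

theory Defs
  imports "HOL-Analysis.Product_Topology" "HOL-Algebra.Group_Action" "HOL-Algebra.Left_Coset"
begin

text \<open>No separation axiom is imposed on the topology.\<close>

locale topological_group = group G for G (structure) +
  fixes T :: "'a topology"
  assumes topspace_eq: "topspace T = carrier G"
    and continuous_mult: "continuous_map (prod_topology T T) T (\<lambda>(g, h). g \<otimes> h)"
    and continuous_inv: "continuous_map T T (\<lambda>g. inv g)"

definition coset_topology :: "('a, 'm) monoid_scheme \<Rightarrow> 'a topology \<Rightarrow> 'a set \<Rightarrow> 'a set topology"
  where "coset_topology G T E = topology (\<lambda>U. U \<subseteq> lcosets\<^bsub>G\<^esub> E \<and> openin T (\<Union>U))"

definition accumulates_at :: "'b topology \<Rightarrow> 'b set \<Rightarrow> 'b \<Rightarrow> bool"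
  where "accumulates_at X S p \<longleftrightarrow> p \<notin> S \<and> p \<in> Abstract_Topology.closure_of X S"

text \<open>
  The action of \<open>H\<close> on \<open>G/E\<close> is written as left translation; for \<open>H \<subseteq> E\<close> this
  is the conjugation action, see \<open>conj_lcoset_eq\<close> below.
\<close>

definition distal_at_one :: "('a, 'm) monoid_scheme \<Rightarrow> 'a topology \<Rightarrow> 'a set \<Rightarrow> 'a set \<Rightarrow> bool"
  where "distal_at_one G T H E \<longleftrightarrow>
    (\<forall>C \<in> lcosets\<^bsub>G\<^esub> E. C \<noteq> E \<longrightarrow>
       \<not> accumulates_at (coset_topology G T E) ((\<lambda>h. h <#\<^bsub>G\<^esub> C) ` H) E)"

definition distal_subgroup :: "('a, 'm) monoid_scheme \<Rightarrow> 'a topology \<Rightarrow> 'a set \<Rightarrow> 'a set \<Rightarrow> bool"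
  where "distal_subgroup G T H E \<longleftrightarrow>
    subgroup E G \<and> closedin T E \<and> H \<subseteq> E \<and> distal_at_one G T H E"

text \<open>
  The group \<open>Dist\<^sup>*\<close> of \<open>H\<close> on \<open>G/H\<close>. The intersection is itself a distal
  subgroup, hence the smallest one, see \<open>Dist_star_least\<close> below.
\<close>

definition Dist_star :: "('a, 'm) monoid_scheme \<Rightarrow> 'a topology \<Rightarrow> 'a set \<Rightarrow> 'a set"
  where "Dist_star G T H = \<Inter> {E. distal_subgroup G T H E}"


lemma (in group) conj_lcoset_eq:
  assumes E: "subgroup E G" and "H \<subseteq> E" "h \<in> H" "g \<in> carrier G"
  shows "h <# (g <# E) #> inv h = h <# (g <# E)"
    and "(h \<otimes> g \<otimes> inv h) <# E = h <# (g <# E)"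
proof -
  interpret subgroup E G by fact
  have h: "h \<in> E" "h \<in> carrier G" using assms by auto
  have hE: "inv h <# E = E" using h by (simp add: coset_join3 E)
  have Eh: "E #> inv h = E" using h by (simp add: coset_join2 E)
  have 1: "h <# (g <# E) = (h \<otimes> g) <# E"
    using lcos_m_assoc[OF subset] h assms by blast
  have "((h \<otimes> g) <# E) #> inv h = (h \<otimes> g) <# (E #> inv h)"
    using h assms by (simp add: coset_assoc[OF _ _ subset])
  then show "h <# (g <# E) #> inv h = h <# (g <# E)" using 1 Eh by simp
  have "(h \<otimes> g \<otimes> inv h) <# E = (h \<otimes> g) <# (inv h <# E)"
    by (rule lcos_m_assoc[OF subset, symmetric]) (use h assms in simp_all)
  then show "(h \<otimes> g \<otimes> inv h) <# E = h <# (g <# E)" using 1 hE by simp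
qed

context topological_group
begin

lemma openin_coset_topology:
  assumes "subgroup E G"
  shows "openin (coset_topology G T E) U \<longleftrightarrow> U \<subseteq> lcosets E \<and> openin T (\<Union>U)"
proof -
  have "istopology (\<lambda>U. U \<subseteq> lcosets E \<and> openin T (\<Union>U))"
    unfolding istopology_def
  proof (rule conjI; clarify)
    fix S U assume SU: "S \<subseteq> lcosets E" "openin T (\<Union>S)" "U \<subseteq> lcosets E" "openin T (\<Union>U)"
    have "C = D" if "C \<in> S" "D \<in> U" "y \<in> C" "y \<in> D" for C D y
      using lcos_disjoint[OF assms, of C D] that SU(1,3) by blast
    then have "\<Union>(S \<inter> U) = \<Union>S \<inter> \<Union>U"
      by blast
    then show "S \<inter> U \<subseteq> lcosets E \<and> openin T (\<Union>(S \<inter> U))"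
      using SU by auto
  next
    fix K assume K: "\<forall>U\<in>K. U \<subseteq> lcosets E \<and> openin T (\<Union>U)"
    have "\<Union>(\<Union>K) = \<Union>((\<lambda>U. \<Union>U) ` K)" by auto
    moreover have "openin T (\<Union>((\<lambda>U. \<Union>U) ` K))"
      using K by (intro openin_Union) auto
    ultimately show "\<Union>K \<subseteq> lcosets E \<and> openin T (\<Union>(\<Union>K))"
      using K by auto
  qed
  then show ?thesis
    by (simp add: coset_topology_def topology_inverse')
qed

lemma topspace_coset_topology:
  assumes "subgroup E G"
  shows "topspace (coset_topology G T E) = lcosets E"
proof -
  have "openin (coset_topology G T E) (lcosets E)"
    using openin_coset_topology[OF assms] lcosets_part_G[OF assms] topspace_eq openin_topspace[of T]
    by simp
  then show ?thesis
    using openin_coset_topology[OF assms]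
    by (meson openin_subset openin_topspace subset_antisym)
qed

lemma quotient_map_lcoset:
  assumes E: "subgroup E G"
  shows "quotient_map T (coset_topology G T E) (\<lambda>g. g <# E)"
proof -
  have im: "(\<lambda>g. g <# E) ` topspace T = lcosets E"
    by (auto simp: LCOSETS_def topspace_eq)
  have "{x \<in> topspace T. x <# E \<in> U} = \<Union>U" if U: "U \<subseteq> lcosets E" for U
  proof
    show "{x \<in> topspace T. x <# E \<in> U} \<subseteq> \<Union>U"
      using lcos_self[OF _ E] by (auto simp: topspace_eq)
    show "\<Union>U \<subseteq> {x \<in> topspace T. x <# E \<in> U}"
    proof
      fix y assume "y \<in> \<Union>U"
      then obtain C where C: "C \<in> U" "y \<in> C" by auto
      then have Cl: "C \<in> lcosets E" using U by auto
      then have y: "y \<in> carrier G" using C lcosets_part_G[OF E] by auto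
      then have "y <# E \<in> lcosets E" by (auto simp: LCOSETS_def)
      then have "y <# E = C"
        using lcos_disjoint[OF E _ Cl] C lcos_self[OF y E] by blast
      then show "y \<in> {x \<in> topspace T. x <# E \<in> U}" using C y by (simp add: topspace_eq)
    qed
  qed
  then show ?thesis
    unfolding quotient_map_def topspace_coset_topology[OF E] using im
    by (auto simp: openin_coset_topology[OF E])
qed

lemma Dist_star_least:
  assumes H: "subgroup H G"
  shows "distal_subgroup G T H (Dist_star G T H)"
    and "distal_subgroup G T H E \<Longrightarrow> Dist_star G T H \<subseteq> E"
proof -
  show "Dist_star G T H \<subseteq> E" if "distal_subgroup G T H E" for E
    using that by (auto simp: Dist_star_def)
  let ?F = "{E. distal_subgroup G T H E}" and ?D = "Dist_star G T H"
  have "lcosets (carrier G) = {carrier G}"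
    using coset_join3[OF _ subgroup_self] by (auto simp: LCOSETS_def)
  then have G: "carrier G \<in> ?F"
    using subgroup.subset[OF H] closedin_topspace[of T]
    by (auto simp: distal_subgroup_def distal_at_one_def subgroup_self topspace_eq)
  have D: "subgroup ?D G"
    unfolding Dist_star_def
    by (rule subgroups_Inter) (use G in \<open>auto simp: distal_subgroup_def\<close>)
  have cl: "closedin T ?D"
    unfolding Dist_star_def using G by (intro closedin_Inter) (auto simp: distal_subgroup_def)
  have HD: "H \<subseteq> ?D" by (auto simp: Dist_star_def distal_subgroup_def)
  have "distal_at_one G T H ?D"
    unfolding distal_at_one_def
  proof (intro ballI impI notI)
    fix C assume C: "C \<in> lcosets ?D" "C \<noteq> ?D"
      and acc: "accumulates_at (coset_topology G T ?D) ((\<lambda>h. h <# C) ` H) ?D"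
    from C obtain g where g: "g \<in> carrier G" "C = g <# ?D" by (auto simp: LCOSETS_def)
    then have "g \<notin> ?D" using C coset_join3[OF _ D] by auto
    then obtain E where F: "distal_subgroup G T H E" and gE: "g \<notin> E"
      by (auto simp: Dist_star_def)
    have E: "subgroup E G" and HE: "H \<subseteq> E" using F by (auto simp: distal_subgroup_def)
    have DE: "?D \<subseteq> E" using F by (auto simp: Dist_star_def)
    let ?p = "\<lambda>C. C <#> E"
    have p: "?p (a <# ?D) = a <# E" if a: "a \<in> carrier G" for a
    proof -
      have "?D <#> E = E"
      proof
        show "?D <#> E \<subseteq> E" using DE subgroup.m_closed[OF E] by (auto simp: set_mult_def)
        show "E \<subseteq> ?D <#> E"
        proof
          fix y assume "y \<in> E"
          then have "\<one> \<otimes> y = y" using subgroup.mem_carrier[OF E] by simp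
          then show "y \<in> ?D <#> E"
            using subgroup.one_closed[OF D] \<open>y \<in> E\<close> unfolding set_mult_def by blast
        qed
      qed
      moreover have "(a <# ?D) <#> E = a <# (?D <#> E)"
        using a subgroup.subset[OF D] subgroup.subset[OF E]
        by (simp add: l_coset_eq_set_mult set_mult_assoc)
      ultimately show ?thesis by simp
    qed
    have "continuous_map T (coset_topology G T E) (?p \<circ> (\<lambda>a. a <# ?D))"
      by (rule continuous_map_eq[OF quotient_imp_continuous_map[OF quotient_map_lcoset[OF E]]])
         (auto simp: p topspace_eq)
    then have cont: "continuous_map (coset_topology G T ?D) (coset_topology G T E) ?p"
      using continuous_compose_quotient_map[OF quotient_map_lcoset[OF D]] by blast
    have pD: "?p ?D = E" 
      using p[OF one_closed] lcos_mult_one[OF subgroup.subset[OF D]] lcos_mult_one[OF subgroup.subset[OF E]]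
      by simp
    have tr: "h <# (g <# K) = (h \<otimes> g) <# K" if "h \<in> H" "subgroup K G" for h K
      by (rule lcos_m_assoc[OF subgroup.subset[OF that(2)] subgroup.mem_carrier[OF H that(1)] g(1)])
    have im: "?p ` ((\<lambda>h. h <# C) ` H) = (\<lambda>h. h <# (g <# E)) ` H"
      unfolding image_image g(2)
      by (rule image_cong) (use p tr[OF _ D] tr[OF _ E] g subgroup.mem_carrier[OF H] in auto)
    have "?D \<in> Abstract_Topology.closure_of (coset_topology G T ?D) ((\<lambda>h. h <# C) ` H)"
      using acc by (simp add: accumulates_at_def)
    then have clo: "E \<in> Abstract_Topology.closure_of (coset_topology G T E) ((\<lambda>h. h <# (g <# E)) ` H)"
      using continuous_map_image_closure_subset[OF cont] im pD by (metis imageI subsetD)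
    have "E \<notin> (\<lambda>h. h <# (g <# E)) ` H"
    proof
      assume "E \<in> (\<lambda>h. h <# (g <# E)) ` H"
      then obtain h where h: "h \<in> H" "E = (h \<otimes> g) <# E" using tr[OF _ E] by auto
      then have "h \<otimes> g \<in> E"
        using lcos_self[OF _ E] g subgroup.mem_carrier[OF H] by (metis m_closed)
      then have "inv h \<otimes> (h \<otimes> g) \<in> E"
        using h HE E by (meson subgroup.m_closed subgroup.m_inv_closed subsetD)
      then show False
        using gE g h subgroup.mem_carrier[OF H] by (simp add: m_assoc[symmetric])
    qed
    moreover have "g <# E \<in> lcosets E" using g by (auto simp: LCOSETS_def)
    moreover have "g <# E \<noteq> E" using gE lcos_self[OF g(1) E] by auto
    ultimately show False
      using F clo by (auto simp: distal_subgroup_def distal_at_one_def accumulates_at_def)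
  qed
  then show "distal_subgroup G T H ?D"
    using D cl HD by (simp add: distal_subgroup_def)
qed

end

end

theory Submission
  imports Defs
begin

text \<open>
  The stabiliser \<open>E\<close> of \<open>x\<close> is a distal subgroup, hence contains \<open>Dist\<^sup>*\<close>. Since \<open>X\<close> need
  not be \<open>T\<^sub>1\<close>, closedness of \<open>E\<close> uses the accumulation hypothesis: a point \<open>y \<noteq> x\<close> never has \<open>x\<close> in
  its closure, so, translating by \<open>g\<inverse>\<close>, \<open>g x\<close> lies in the closure of \<open>x\<close> only if \<open>g x = x\<close>. Hence
  \<open>E\<close> is the preimage of the closure of \<open>x\<close> under the orbit map. Distality holds because the orbit map
  factors through a continuous \<open>H\<close>-equivariant injection of \<open>G/E\<close> into \<open>X\<close>.
\<close>

text \<open>Both sides say that \<open>inv g \<otimes> k\<close> fixes \<open>x\<close>. Read left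
  to right, this makes the orbit map constant on cosets; read right to left, it makes the induced
  map on cosets injective.\<close>

lemma (in group_action) lcoset_stabilizer_eq_iff:
  assumes "x \<in> E" "g \<in> carrier G" "k \<in> carrier G"
  shows "g <#\<^bsub>G\<^esub> stabilizer G \<phi> x = k <#\<^bsub>G\<^esub> stabilizer G \<phi> x \<longleftrightarrow> \<phi> g x = \<phi> k x"
proof -
  interpret G: group G using group_hom by (simp add: group_hom_def)
  have S: "subgroup (stabilizer G \<phi> x) G" by (rule stabilizer_subgroup[OF assms(1)])
  have "g <#\<^bsub>G\<^esub> stabilizer G \<phi> x = k <#\<^bsub>G\<^esub> stabilizer G \<phi> x \<longleftrightarrow>
      inv\<^bsub>G\<^esub> g \<otimes>\<^bsub>G\<^esub> k \<in> stabilizer G \<phi> x"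
  proof
    assume "g <#\<^bsub>G\<^esub> stabilizer G \<phi> x = k <#\<^bsub>G\<^esub> stabilizer G \<phi> x"
    then have "k \<in> g <#\<^bsub>G\<^esub> stabilizer G \<phi> x"
      using G.lcos_self[OF assms(3) S] by simp
    then obtain s where s: "s \<in> stabilizer G \<phi> x" "k = g \<otimes>\<^bsub>G\<^esub> s"
      by (auto simp: l_coset_def)
    then show "inv\<^bsub>G\<^esub> g \<otimes>\<^bsub>G\<^esub> k \<in> stabilizer G \<phi> x"
      using assms subgroup.mem_carrier[OF S] by (simp add: G.m_assoc[symmetric])
  next
    assume s: "inv\<^bsub>G\<^esub> g \<otimes>\<^bsub>G\<^esub> k \<in> stabilizer G \<phi> x"
    have "k = g \<otimes>\<^bsub>G\<^esub> (inv\<^bsub>G\<^esub> g \<otimes>\<^bsub>G\<^esub> k)"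
      using assms by (simp add: G.m_assoc[symmetric])
    then have "k \<in> g <#\<^bsub>G\<^esub> stabilizer G \<phi> x"
      using s by (auto simp: l_coset_def)
    then show "g <#\<^bsub>G\<^esub> stabilizer G \<phi> x = k <#\<^bsub>G\<^esub> stabilizer G \<phi> x"
      by (rule G.l_repr_independence[OF _ assms(2) S])
  qed
  also have "\<dots> \<longleftrightarrow> \<phi> (inv\<^bsub>G\<^esub> g) (\<phi> k x) = x"
    using assms by (simp add: stabilizer_def composition_rule)
  also have "\<dots> \<longleftrightarrow> \<phi> g x = \<phi> k x"
  proof
    assume "\<phi> (inv\<^bsub>G\<^esub> g) (\<phi> k x) = x"
    then show "\<phi> g x = \<phi> k x"
      using orbit_sym_aux[of "inv\<^bsub>G\<^esub> g" "\<phi> k x" x] assms element_image[OF assms(3,1) refl]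
      by simp
  next
    assume "\<phi> g x = \<phi> k x"
    then show "\<phi> (inv\<^bsub>G\<^esub> g) (\<phi> k x) = x"
      by (rule orbit_sym_aux[OF assms(2,1)])
  qed
  finally show ?thesis .
qed

text \<open>The orbit map is constant on the cosets of the stabiliser, so it descends along the
  quotient map onto the coset space; the universal property of that map gives continuity.\<close>

lemma (in topological_group) continuous_lift_stabilizer:
  assumes act: "group_action G (topspace X) \<phi>" and x: "x \<in> topspace X"
    and cont: "continuous_map T X (\<lambda>g. \<phi> g x)"
  obtains p where "continuous_map (coset_topology G T (stabilizer G \<phi> x)) X p"
    and "\<And>g. g \<in> carrier G \<Longrightarrow> p (g <# stabilizer G \<phi> x) = \<phi> g x"
proof -
  have "subgroup (stabilizer G \<phi> x) G"
    by (rule group_action.stabilizer_subgroup[OF act x])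
  then obtain p where "continuous_map (coset_topology G T (stabilizer G \<phi> x)) X p"
    and "\<And>g. g \<in> topspace T \<Longrightarrow> p (g <# stabilizer G \<phi> x) = \<phi> g x"
    using quotient_map_lift_exists[OF quotient_map_lcoset cont]
      group_action.lcoset_stabilizer_eq_iff[OF act x] topspace_eq by metis
  then show ?thesis using that topspace_eq by metis
qed

lemma (in topological_group) closedin_stabilizer:
  assumes act: "group_action G (topspace X) \<phi>" and x: "x \<in> topspace X"
    and act_cont: "\<And>g. g \<in> carrier G \<Longrightarrow> continuous_map X X (\<phi> g)"
    and orb_cont: "continuous_map T X (\<lambda>g. \<phi> g x)"
    and sep: "\<And>y. y \<in> topspace X - {x} \<Longrightarrow> x \<notin> X closure_of {y}"
  shows "closedin T (stabilizer G \<phi> x)"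
proof -
  interpret group_action G "topspace X" \<phi> by fact
  have fixed: "\<phi> g x = x" if g: "g \<in> carrier G" and cl: "\<phi> g x \<in> X closure_of {x}" for g
  proof -
    \<comment> \<open>Continuity of \<open>\<phi> (inv g)\<close> moves the closure relation so that
      \<open>x\<close> itself becomes the limit point, the only point for which \<open>sep\<close>
      says anything.\<close>
    have "\<phi> (inv g) (\<phi> g x) \<in> X closure_of (\<phi> (inv g) ` {x})"
      using continuous_map_image_closure_subset[OF act_cont[of "inv g"], of "{x}"] g cl by auto
    then have "x \<in> X closure_of {\<phi> (inv g) x}"
      using orbit_sym_aux[OF g x refl] by simp
    then have "\<phi> (inv g) x = x"
      using sep[of "\<phi> (inv g) x"] element_image[of "inv g" x] g x by auto
    then show ?thesis
      using orbit_sym_aux[of "inv g" x x] g x by simp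
  qed
  have "x \<in> X closure_of {x}"
    using closure_of_subset[of "{x}" X] x by auto
  then have "stabilizer G \<phi> x = {g \<in> topspace T. \<phi> g x \<in> X closure_of {x}}"
    using fixed by (auto simp: stabilizer_def topspace_eq)
  then show ?thesis
    using closedin_continuous_map_preimage[OF orb_cont closedin_closure_of] by simp
qed

theorem theorem1p14:
  fixes G :: "('a, 'm) monoid_scheme" (structure)
    and T :: "'a topology"
    and H :: "'a set"
    and X :: "'b topology"
    and \<phi> :: "'a \<Rightarrow> 'b \<Rightarrow> 'b"
    and x :: 'b
  assumes "topological_group G T"
    and "subgroup H G"
    and "carrier G = Dist_star G T H"
    and "group_action G (topspace X) \<phi>"
    and "\<And>g. g \<in> carrier G \<Longrightarrow> homeomorphic_map X X (\<phi> g)"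
    and "\<And>y. y \<in> topspace X \<Longrightarrow> continuous_map T X (\<lambda>g. \<phi> g y)"
    and "x \<in> topspace X"
    and "\<And>h. h \<in> H \<Longrightarrow> \<phi> h x = x"
    and "\<And>y. y \<in> topspace X - {x} \<Longrightarrow>
           \<not> accumulates_at X (orbit (G\<lparr>carrier := H\<rparr>) \<phi> y) x"
  shows "\<forall>g \<in> carrier G. \<phi> g x = x"
proof -
  interpret topological_group G T by fact
  interpret group_action G "topspace X" \<phi> by fact
  interpret H: subgroup H G by fact
  note x = \<open>x \<in> topspace X\<close>
  let ?E = "stabilizer G \<phi> x"
  have E: "subgroup ?E G" by (rule stabilizer_subgroup[OF x])
  have orb: "x \<notin> X closure_of ((\<lambda>h. \<phi> h y) ` H)" if y: "y \<in> topspace X - {x}" for y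
  proof -
    have eq: "orbit (G\<lparr>carrier := H\<rparr>) \<phi> y = (\<lambda>h. \<phi> h y) ` H"
      by (auto simp: orbit_def)
    \<comment> \<open>Negating \<open>accumulates_at\<close> leaves the alternative that
      \<open>x\<close> lies on the orbit. It is ruled out because \<open>H\<close> fixes
      \<open>x\<close>, so no other point is moved to \<open>x\<close>.\<close>
    have "x \<notin> (\<lambda>h. \<phi> h y) ` H"
    proof
      assume "x \<in> (\<lambda>h. \<phi> h y) ` H"
      then obtain h where h: "h \<in> H" "\<phi> h y = x" by auto
      then have "\<phi> (inv h) x = y" using orbit_sym_aux[of h y x] y by auto
      then show False using assms(8)[of "inv h"] h y by auto
    qed
    then show ?thesis using assms(9)[OF y] eq by (simp add: accumulates_at_def)
  qed
  have "closedin T ?E"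
  proof (rule closedin_stabilizer[OF assms(4) x])
    show "continuous_map X X (\<phi> g)" if "g \<in> carrier G" for g
      using assms(5)[OF that] by (rule homeomorphic_imp_continuous_map)
    show "x \<notin> X closure_of {y}" if y: "y \<in> topspace X - {x}" for y
    proof -
      \<comment> \<open>The point \<open>y\<close> lies on its own \<open>H\<close>-orbit, so the
        condition on single points follows from \<open>orb\<close> by monotonicity of
        closure.\<close>
      have "\<phi> \<one> y = y" using y by (simp add: id_eq_one[symmetric])
      then have "{y} \<subseteq> (\<lambda>h. \<phi> h y) ` H"
        using imageI[OF H.one_closed, of "\<lambda>h. \<phi> h y"] by simp
      then show ?thesis using orb[OF y] closure_of_mono by blast
    qed
  qed (rule assms(6)[OF x])
  moreover have "H \<subseteq> ?E" using assms(8) by (auto simp: stabilizer_def)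
  moreover have "distal_at_one G T H ?E"
    unfolding distal_at_one_def
  proof (intro ballI impI notI)
    fix C assume C: "C \<in> lcosets ?E" "C \<noteq> ?E"
      and acc: "accumulates_at (coset_topology G T ?E) ((\<lambda>h. h <# C) ` H) ?E"
    obtain p where p: "continuous_map (coset_topology G T ?E) X p"
      "\<And>g. g \<in> carrier G \<Longrightarrow> p (g <# ?E) = \<phi> g x"
      using continuous_lift_stabilizer[OF assms(4) x assms(6)[OF x]] by blast
    from C obtain g where g: "g \<in> carrier G" "C = g <# ?E" by (auto simp: LCOSETS_def)
    have one: "\<one> <# ?E = ?E" by (rule lcos_mult_one[OF subgroup.subset[OF E]])
    have one_x: "\<phi> \<one> x = x" using assms(8) H.one_closed by blast
    \<comment> \<open>Injectivity on cosets, with \<open>\<one>\<close> as second representative: a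
      non-trivial coset cannot be sent to \<open>x\<close>.\<close>
    have gx: "\<phi> g x \<in> topspace X - {x}"
      using C g lcoset_stabilizer_eq_iff[OF x g(1) one_closed] one one_x
        element_image[OF g(1) x refl] by auto
    have "p (h <# C) = \<phi> h (\<phi> g x)" if "h \<in> H" for h
      using that g p(2)[of "h \<otimes> g"] x
      by (simp add: lcos_m_assoc[OF subgroup.subset[OF E]] composition_rule)
    then have im: "p ` ((\<lambda>h. h <# C) ` H) = (\<lambda>h. \<phi> h (\<phi> g x)) ` H"
      unfolding image_image by (rule image_cong[OF refl])
    \<comment> \<open>As \<open>p\<close> is continuous and \<open>H\<close>-equivariant with
      \<open>p ?E = x\<close>, accumulation at the trivial coset would put \<open>x\<close> in the
      closure of the \<open>H\<close>-orbit of \<open>\<phi> g x\<close>, against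
      \<open>orb\<close>.\<close>
    have "p ?E \<in> X closure_of (p ` ((\<lambda>h. h <# C) ` H))"
      using acc continuous_map_image_closure_subset[OF p(1)] unfolding accumulates_at_def by blast
    then show False
      using im orb[OF gx] p(2)[OF one_closed] one one_x by simp
  qed
  ultimately have "distal_subgroup G T H ?E"
    using E by (simp add: distal_subgroup_def)
  then have "carrier G \<subseteq> ?E"
    using Dist_star_least(2)[OF assms(2)] assms(3) by simp
  then show ?thesis by (auto simp: stabilizer_def)
qed

end
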